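(* The Markov policy $\pi^*=(\widetilde g_0,\widetilde g_1,\ldots)$ with $\widetilde g_n(\cdot)=f^*(\cdot,\gamma\beta^n)$ is optimal for the exponential utility problem, that is, $$\widetilde J(x)=\widetilde J_{\pi^*}(x)=\frac1\gamma J_{\pi^*}(x,\gamma)=\frac1\gamma J(x,\gamma)\qquad\text{for all }x\in X.$$
   Context: Setting. $X=\mathbb{Z}$, $\beta\in(0,1)$ is a discount factor, $Z_1,Z_2,\ldots$ are i.i.d. integer-valued random variables with $\mathbb{P}(Z_n=k)=q_k$, $k\in\mathbb{Z}$; $Z$ denotes a generic copy. Standing assumptions: $\mathbb{E}Z^+<\infty$ (where $Z^+=\max\{Z,0\}$) and $\mathbb{P}(Z<0)>0$. Action sets: $A(x)=\{0,\ldots,x\}$ for $x\ge0$ and $A(x)=\{0\}$ for $x<0$; $D=\{(x,a):x\in X,a\in A(x)\}$. A policy $\pi=(\pi_k)_{k\ge0}$ is a sequence of maps assigning to each history $(x_0,a_0,\ldots,x_{k-1},a_{k-1},x_k)$ with $(x_m,a_m)\in D$ an action in $A(x_k)$; $\Pi$ is the set of all policies. A Markov policy is one of the form $\pi=(g_k)_{k\ge0}$ with $a_k=g_k(x_k)$, where $g_k$ maps each $x\in X$ into $A(x)$. Under $\pi$ and $x_0=x$, $a_k=\pi_k(x_0,a_0,\ldots,x_k)$, and $x_{k+1}=x_k-a_k+Z_{k+1}$ if $x_k\ge0$, $x_{k+1}=x_k$ if $x_k<0$; expectation is $\mathbb{E}_x^\pi$. Fix $\gamma<0$ and let $I=[\gamma,0)$,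 $U_\gamma(x)=\frac1\gamma e^{\gamma x}$. Define $$\widetilde J_\pi(x)=\mathbb{E}_x^\pi U_\gamma\Big(\sum_{k=0}^\infty\beta^k a_k\Big),\qquad \widetilde J(x)=\sup_{\pi\in\Pi}\widetilde J_\pi(x),$$ and for $(x,\theta)\in X\times I$, $$J_\pi(x,\theta)=\mathbb{E}_x^\pi\exp\Big\{\theta\sum_{k=0}^\infty\beta^k a_k\Big\},\qquad J(x,\theta)=\inf_{\pi\in\Pi}J_\pi(x,\theta).$$ For $x\ge0$, $\theta\in I$ let $G(x,\theta)=\sum_{k=-x}^\infty J(x+k,\theta)q_k+\sum_{k=-\infty}^{-x-1}q_k$. For $x\ge0$, $f^*(x,\theta)$ is the largest minimiser over $a\in A(x)$ of $a\mapsto e^{\theta a}G(x-a,\theta\beta)$; for $x<0$, $f^*(x,\theta)=0$. *)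

theory Defs
  imports "HOL-Probability.Probability"
begin

definition actions :: "int \<Rightarrow> int set" where
  "actions x = (if 0 \<le> x then {0..x} else {0})"

definition state_actions :: "(int \<times> int) set" where
  "state_actions = {(x, a). a \<in> actions x}"

text \<open>In \<open>\<pi> k h x\<close> the list \<open>h\<close> is \<open>[(x\<^sub>0, a\<^sub>0), \<dots>, (x\<^bsub>k-1\<^esub>, a\<^bsub>k-1\<^esub>)]\<close>,
  oldest entry first, and \<open>x\<close> is the current state \<open>x\<^sub>k\<close>.\<close>

type_synonym policy = "nat \<Rightarrow> (int \<times> int) list \<Rightarrow> int \<Rightarrow> int"

text \<open>Values on lists that are not histories of length \<open>k\<close> over \<^const>\<open>state_actions\<close> are
  unconstrained; they never enter the controlled process.\<close>

definition policies :: "policy set" where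
  "policies = {\<pi>. \<forall>k h x. length h = k \<and> set h \<subseteq> state_actions \<longrightarrow> \<pi> k h x \<in> actions x}"

definition markov :: "(nat \<Rightarrow> int \<Rightarrow> int) \<Rightarrow> policy" where
  "markov g = (\<lambda>k h x. g k x)"

definition markov_policies :: "policy set" where
  "markov_policies = {\<pi> \<in> policies. \<exists>g. (\<forall>k x. g k x \<in> actions x) \<and> \<pi> = markov g}"

text \<open>The controlled process along one realisation \<open>z 1, z 2, \<dots>\<close> of the increments (\<open>z 0\<close> is not
  used): the pair of the past up to time \<open>k\<close> and the state at time \<open>k\<close>.\<close>

primrec history :: "policy \<Rightarrow> int \<Rightarrow> (nat \<Rightarrow> int) \<Rightarrow> nat \<Rightarrow> (int \<times> int) list \<times> int" where
  "history \<pi> x z 0 = ([], x)"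
| "history \<pi> x z (Suc k) =
     (let (h, y) = history \<pi> x z k; a = \<pi> k h y
      in (h @ [(y, a)], if 0 \<le> y then y - a + z (Suc k) else y))"

definition act :: "policy \<Rightarrow> int \<Rightarrow> (nat \<Rightarrow> int) \<Rightarrow> nat \<Rightarrow> int" where
  "act \<pi> x z k = (let (h, y) = history \<pi> x z k in \<pi> k h y)"

text \<open>If the positive parts of the increments are integrable, this series converges almost surely
  under every policy, so the value of \<^const>\<open>suminf\<close> on divergent paths does not affect
  expectations.\<close>

definition total_reward :: "real \<Rightarrow> policy \<Rightarrow> int \<Rightarrow> (nat \<Rightarrow> int) \<Rightarrow> real" where
  "total_reward \<beta> \<pi> x z = (\<Sum>k. \<beta> ^ k * real_of_int (act \<pi> x z k))"

definition exp_utility :: "real \<Rightarrow> real \<Rightarrow> real" where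
  "exp_utility \<gamma> y = 1 / \<gamma> * exp (\<gamma> * y)"

definition utility_of :: "'w measure \<Rightarrow> (nat \<Rightarrow> 'w \<Rightarrow> int) \<Rightarrow> real \<Rightarrow> real \<Rightarrow> policy \<Rightarrow> int \<Rightarrow> real" where
  "utility_of M Z \<beta> \<gamma> \<pi> x = (LINT \<omega>|M. exp_utility \<gamma> (total_reward \<beta> \<pi> x (\<lambda>n. Z n \<omega>)))"

definition utility_opt :: "'w measure \<Rightarrow> (nat \<Rightarrow> 'w \<Rightarrow> int) \<Rightarrow> real \<Rightarrow> real \<Rightarrow> int \<Rightarrow> real" where
  "utility_opt M Z \<beta> \<gamma> x = (SUP \<pi>\<in>policies. utility_of M Z \<beta> \<gamma> \<pi> x)"

definition J_of :: "'w measure \<Rightarrow> (nat \<Rightarrow> 'w \<Rightarrow> int) \<Rightarrow> real \<Rightarrow> policy \<Rightarrow> int \<Rightarrow> real \<Rightarrow> real" where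
  "J_of M Z \<beta> \<pi> x \<theta> = (LINT \<omega>|M. exp (\<theta> * total_reward \<beta> \<pi> x (\<lambda>n. Z n \<omega>)))"

definition J_opt :: "'w measure \<Rightarrow> (nat \<Rightarrow> 'w \<Rightarrow> int) \<Rightarrow> real \<Rightarrow> int \<Rightarrow> real \<Rightarrow> real" where
  "J_opt M Z \<beta> x \<theta> = (INF \<pi>\<in>policies. J_of M Z \<beta> \<pi> x \<theta>)"

definition G :: "'w measure \<Rightarrow> (nat \<Rightarrow> 'w \<Rightarrow> int) \<Rightarrow> (int \<Rightarrow> real) \<Rightarrow> real \<Rightarrow> int \<Rightarrow> real \<Rightarrow> real" where
  "G M Z q \<beta> x \<theta> =
     (\<Sum>\<^sub>\<infinity>k\<in>{-x..}. J_opt M Z \<beta> (x + k) \<theta> * q k) + (\<Sum>\<^sub>\<infinity>k\<in>{..-x - 1}. q k)"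

definition fstar :: "'w measure \<Rightarrow> (nat \<Rightarrow> 'w \<Rightarrow> int) \<Rightarrow> (int \<Rightarrow> real) \<Rightarrow> real \<Rightarrow> int \<Rightarrow> real \<Rightarrow> int" where
  "fstar M Z q \<beta> x \<theta> =
     (if 0 \<le> x
      then Max {a. is_arg_min (\<lambda>a. exp (\<theta> * real_of_int a) * G M Z q \<beta> (x - a) (\<theta> * \<beta>))
                     (\<lambda>a. a \<in> actions x) a}
      else 0)"

definition pi_star :: "'w measure \<Rightarrow> (nat \<Rightarrow> 'w \<Rightarrow> int) \<Rightarrow> (int \<Rightarrow> real) \<Rightarrow> real \<Rightarrow> real \<Rightarrow> policy" where
  "pi_star M Z q \<beta> \<gamma> = markov (\<lambda>n x. fstar M Z q \<beta> x (\<gamma> * \<beta> ^ n))"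

end

theory Submission
  imports Defs
begin

text \<open>
  Since \<open>exp_utility \<gamma> y = (1 / \<gamma>) exp (\<gamma> y)\<close> with \<open>\<gamma> < 0\<close>, maximising the utility amounts to
  minimising the cost \<open>J_of\<close>, the expectation of \<open>exp (\<theta> \<cdot> total reward)\<close> at \<open>\<theta> = \<gamma>\<close>.  After an
  action \<open>a\<close> the factor \<open>exp (\<theta> a)\<close> splits off and the rest is a cost of the same kind with
  parameter \<open>\<theta> \<beta>\<close>.  So the natural candidate for the optimal cost is a fixed point of the Bellman
  operator on functions of \<open>(x, \<theta>)\<close>, and it is obtained by value iteration started at the
  constant \<open>1\<close>: the iterates decrease, and their limit \<open>V\<close> (\<open>limit_value\<close>) is a fixed point because
  each action set is finite and each expectation passes to the limit (\<open>limit_value_fixpoint\<close>).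

  For a policy, let \<open>S n\<close> be the discounted sum of the first \<open>n\<close> actions and \<open>X n\<close> the state at time
  \<open>n\<close>, and consider \<open>C n\<close>, the expectation of \<open>exp (\<theta> S n) V (X n) (\<theta> \<beta>^n)\<close>
  (\<open>continuation_cost\<close>).  The increment \<open>Z (n + 1)\<close> is independent of the past, so the passage from
  \<open>C n\<close> to \<open>C (n + 1)\<close> is an application of the Bellman equation under the expectation: \<open>C\<close>
  does not decrease along any policy and is constant along a policy that always takes a minimising action.
  As \<open>C 0 = V x \<theta>\<close> and \<open>V \<le> 1\<close>, letting \<open>n\<close> tend to infinity shows that no policy costs less than
  \<open>V x \<theta>\<close> (\<open>limit_value_le_J_of\<close>).

  For a minimising policy the converse requires that \<open>V (X n) (\<theta> \<beta>^n)\<close> tends to \<open>1\<close> in mean.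
  Now \<open>1 - V x \<theta>\<close> is at most \<open>\<bar>\<theta>\<bar>\<close> times a bound for the expected discounted reward that
  can still be collected from \<open>x\<close>, which grows linearly in the positive part of \<open>x\<close>
  (\<open>one_minus_limit_value_le\<close>).  The expectation of the positive part of \<open>X n\<close> grows at most linearly
  in \<open>n\<close>, and \<open>\<beta>^n\<close> beats this.  So minimising policies attain \<open>V\<close> (\<open>J_of_greedy\<close>), hence
  \<open>V\<close> is the optimal cost \<open>J_opt\<close>, and the minimisers chosen by \<open>fstar\<close>, which are defined
  through \<open>J_opt\<close>, are minimisers of the Bellman equation for \<open>V\<close>.
\<close>

section \<open>Trajectories of the controlled process\<close>

definition successor :: "int \<Rightarrow> int \<Rightarrow> int \<Rightarrow> int" where
  "successor y a z = (if 0 \<le> y then y - a + z else y)"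

abbreviation state :: "policy \<Rightarrow> int \<Rightarrow> (nat \<Rightarrow> int) \<Rightarrow> nat \<Rightarrow> int" where
  "state \<pi> x z n \<equiv> snd (history \<pi> x z n)"

lemma act_eq: "act \<pi> x z n = \<pi> n (fst (history \<pi> x z n)) (state \<pi> x z n)"
  by (simp add: act_def split: prod.split)

lemma history_Suc_eq:
  "history \<pi> x z (Suc n) =
     (fst (history \<pi> x z n) @ [(state \<pi> x z n, act \<pi> x z n)],
      successor (state \<pi> x z n) (act \<pi> x z n) (z (Suc n)))"
  by (simp add: act_eq successor_def Let_def split: prod.split)

text \<open>From here on histories are unfolded through the equation above, which speaks of states and
  actions, in place of the defining equation.\<close>

declare history.simps(2) [simp del]

lemma state_Suc:
  "state \<pi> x z (Suc n) = successor (state \<pi> x z n) (act \<pi> x z n) (z (Suc n))"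
  by (simp add: history_Suc_eq)

lemma history_valid:
  assumes "\<pi> \<in> policies"
  shows "length (fst (history \<pi> x z n)) = n \<and> set (fst (history \<pi> x z n)) \<subseteq> state_actions"
proof (induction n)
  case (Suc n)
  then have "act \<pi> x z n \<in> actions (state \<pi> x z n)"
    using assms by (auto simp: act_eq policies_def)
  with Suc show ?case
    by (auto simp: history_Suc_eq state_actions_def)
qed simp

lemma act_in_actions:
  assumes "\<pi> \<in> policies"
  shows "act \<pi> x z n \<in> actions (state \<pi> x z n)"
  using history_valid[OF assms, of x z n] assms by (auto simp: act_eq policies_def)

lemma actions_bounds:
  assumes "a \<in> actions y"
  shows "0 \<le> a" "a \<le> max y 0"
  using assms by (auto simp: actions_def split: if_splits)

lemma finite_actions [simp]: "finite (actions x)"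
  by (simp add: actions_def)

lemma zero_in_actions [simp]: "0 \<in> actions x"
  by (simp add: actions_def)

lemma actions_nonempty [simp]: "actions x \<noteq> {}"
  using zero_in_actions by blast

lemma history_cong:
  assumes "\<And>i. i \<in> {1..n} \<Longrightarrow> z i = z' i"
  shows "history \<pi> x z n = history \<pi> x z' n"
  using assms by (induction n) (simp_all add: history_Suc_eq act_eq)

lemma state_le:
  assumes "\<pi> \<in> policies"
  shows "state \<pi> x z n \<le> max x 0 + (\<Sum>i=1..n. max (z i) 0)"
proof (induction n)
  case (Suc n)
  have "state \<pi> x z (Suc n) \<le> state \<pi> x z n + max (z (Suc n)) 0"
    using actions_bounds(1)[OF act_in_actions[OF assms, of x z n]]
    by (auto simp: state_Suc successor_def)
  with Suc show ?case by simp
qed simp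

text \<open>For the direction from left to right every pair of a time and a state has to occur behind some
  admissible history; the history that repeats the pair \<open>(0, 0)\<close> serves for all of them.\<close>

lemma markov_in_policies_iff:
  "markov g \<in> policies \<longleftrightarrow> (\<forall>n x. g n x \<in> actions x)"
proof
  assume g: "markov g \<in> policies"
  show "\<forall>n x. g n x \<in> actions x"
  proof (intro allI)
    fix n x
    have "set (replicate n (0, 0)) \<subseteq> state_actions"
      by (auto simp: state_actions_def)
    then show "g n x \<in> actions x"
      using g unfolding policies_def markov_def by (auto dest: spec[of _ "replicate n (0, 0)"])
  qed
qed (simp add: policies_def markov_def)

lemma act_markov: "act (markov g) x z n = g n (state (markov g) x z n)"
  by (simp add: act_eq markov_def)

section \<open>The Bellman equation\<close>

locale bellman_model =
  fixes p :: "int pmf" and \<beta> :: real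
  assumes discount: "0 < \<beta>" "\<beta> < 1"
    and integrable_pos: "integrable p (\<lambda>z. real_of_int (max z 0))"
begin

text \<open>The dependence on \<open>\<theta>\<close> is kept as an argument of the value function because it is rescaled by
  \<open>\<beta>\<close> in every step.  Ruin needs no separate case: below zero the only action is \<open>0\<close> and the
  state stays put.\<close>

definition action_value :: "(int \<Rightarrow> real \<Rightarrow> real) \<Rightarrow> int \<Rightarrow> int \<Rightarrow> real \<Rightarrow> real" where
  "action_value W x a \<theta> =
     exp (\<theta> * real_of_int a) * (LINT z|p. W (successor x a z) (\<theta> * \<beta>))"

definition bellman :: "(int \<Rightarrow> real \<Rightarrow> real) \<Rightarrow> int \<Rightarrow> real \<Rightarrow> real" where
  "bellman W x \<theta> = (MIN a\<in>actions x. action_value W x a \<theta>)"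

primrec value_iter :: "nat \<Rightarrow> int \<Rightarrow> real \<Rightarrow> real" where
  "value_iter 0 = (\<lambda>x \<theta>. 1)"
| "value_iter (Suc n) = bellman (value_iter n)"

definition limit_value :: "int \<Rightarrow> real \<Rightarrow> real" where
  "limit_value x \<theta> = (INF n. value_iter n x \<theta>)"

lemma discount_neg: "\<theta> < 0 \<Longrightarrow> \<theta> * \<beta> < 0"
  using discount by (simp add: mult_neg_pos)

lemma integrable_unit:
  fixes f :: "int \<Rightarrow> real"
  assumes "\<And>y. f y \<in> {0..1}"
  shows "integrable p (\<lambda>z. f (g z))"
  using assms by (intro measure_pmf.integrable_const_bound[where B=1]) auto

lemma bellman_le:
  assumes "a \<in> actions x"
  shows "bellman W x \<theta> \<le> action_value W x a \<theta>"
  unfolding bellman_def using assms by (intro Min_le) auto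

lemma bellman_attained:
  obtains a where "a \<in> actions x" "bellman W x \<theta> = action_value W x a \<theta>"
proof -
  have "bellman W x \<theta> \<in> (\<lambda>a. action_value W x a \<theta>) ` actions x"
    unfolding bellman_def by (intro Min_in) auto
  then show thesis using that by auto
qed

lemma action_value_mono:
  assumes "\<And>y. W y (\<theta> * \<beta>) \<in> {0..1}" "\<And>y. W' y (\<theta> * \<beta>) \<in> {0..1}"
    and "\<And>y. W y (\<theta> * \<beta>) \<le> W' y (\<theta> * \<beta>)"
  shows "action_value W x a \<theta> \<le> action_value W' x a \<theta>"
  unfolding action_value_def using assms
  by (intro mult_left_mono integral_mono integrable_unit[of "\<lambda>y. W y (\<theta> * \<beta>)"]
      integrable_unit[of "\<lambda>y. W' y (\<theta> * \<beta>)"]) auto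

lemma expectation_unit:
  fixes f :: "int \<Rightarrow> real"
  assumes "\<And>y. f y \<in> {0..1}"
  shows "(LINT z|p. f (g z)) \<in> {0..1}"
proof -
  have "(LINT z|p. f (g z)) \<le> (LINT z|p. 1)"
    using assms by (intro integral_mono integrable_unit) auto
  moreover have "0 \<le> (LINT z|p. f (g z))"
    using assms by (intro integral_nonneg_AE) auto
  ultimately show ?thesis by simp
qed

lemma value_iter_unit:
  assumes "\<theta> < 0"
  shows "value_iter n x \<theta> \<in> {0..1}"
  using assms
proof (induction n arbitrary: x \<theta>)
  case (Suc n)
  obtain a where a: "a \<in> actions x"
    "value_iter (Suc n) x \<theta> = action_value (value_iter n) x a \<theta>"
    using bellman_attained[of x "value_iter n" \<theta>] by auto
  have "(LINT z|p. value_iter n (successor x a z) (\<theta> * \<beta>)) \<in> {0..1}"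
    using Suc.IH[OF discount_neg[OF Suc.prems]] by (rule expectation_unit)
  moreover have "exp (\<theta> * real_of_int a) \<le> 1"
    using actions_bounds(1)[OF a(1)] Suc.prems by (simp add: mult_nonpos_nonneg)
  ultimately show ?case
    unfolding a(2) action_value_def by (simp add: mult_le_one)
qed simp

lemma value_iter_Suc_le:
  assumes "\<theta> < 0"
  shows "value_iter (Suc n) x \<theta> \<le> value_iter n x \<theta>"
  using assms
proof (induction n arbitrary: x \<theta>)
  case 0
  then show ?case using value_iter_unit[of \<theta> "Suc 0" x] by simp
next
  case (Suc n)
  obtain a where a: "a \<in> actions x"
    "value_iter (Suc n) x \<theta> = action_value (value_iter n) x a \<theta>"
    using bellman_attained[of x "value_iter n" \<theta>] by auto
  note neg = discount_neg[OF Suc.prems]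
  have "value_iter (Suc (Suc n)) x \<theta> \<le> action_value (value_iter (Suc n)) x a \<theta>"
    using bellman_le[OF a(1)] by simp
  also have "\<dots> \<le> action_value (value_iter n) x a \<theta>"
    by (intro action_value_mono value_iter_unit neg Suc.IH)
  finally show ?case using a(2) by simp
qed

lemma decseq_value_iter: "\<theta> < 0 \<Longrightarrow> decseq (\<lambda>n. value_iter n x \<theta>)"
  by (intro decseq_SucI value_iter_Suc_le)

lemma bdd_below_value_iter: "\<theta> < 0 \<Longrightarrow> bdd_below (range (\<lambda>n. value_iter n x \<theta>))"
  using value_iter_unit by (intro bdd_belowI[where m=0]) auto

lemma value_iter_tendsto:
  "\<theta> < 0 \<Longrightarrow> (\<lambda>n. value_iter n x \<theta>) \<longlonglongrightarrow> limit_value x \<theta>"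
  unfolding limit_value_def
  by (intro LIMSEQ_decseq_INF bdd_below_value_iter decseq_value_iter)

lemma limit_value_le: "\<theta> < 0 \<Longrightarrow> limit_value x \<theta> \<le> value_iter n x \<theta>"
  unfolding limit_value_def by (intro cINF_lower bdd_below_value_iter) auto

lemma limit_value_unit:
  assumes "\<theta> < 0"
  shows "limit_value x \<theta> \<in> {0..1}"
proof -
  have "0 \<le> limit_value x \<theta>"
    unfolding limit_value_def using value_iter_unit[OF assms] by (intro cINF_greatest) auto
  with limit_value_le[OF assms, of x 0] show ?thesis by simp
qed

lemma action_value_tendsto:
  assumes "\<theta> < 0"
  shows "(\<lambda>n. action_value (value_iter n) x a \<theta>) \<longlonglongrightarrow> action_value limit_value x a \<theta>"
proof -
  note neg = discount_neg[OF assms]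
  have "(\<lambda>n. LINT z|p. value_iter n (successor x a z) (\<theta> * \<beta>))
          \<longlonglongrightarrow> (LINT z|p. limit_value (successor x a z) (\<theta> * \<beta>))"
    using value_iter_unit[OF neg]
    by (intro integral_dominated_convergence[where w="\<lambda>_. 1"])
       (auto intro!: value_iter_tendsto neg)
  then show ?thesis unfolding action_value_def by (intro tendsto_mult tendsto_const)
qed

text \<open>One inequality uses that a minimiser for the limit is admissible for every iterate, the other
  that a minimiser for an iterate is admissible for the limit, which lies below the iterate.\<close>

lemma limit_value_fixpoint:
  assumes "\<theta> < 0"
  shows "limit_value x \<theta> = bellman limit_value x \<theta>"
proof (rule antisym)
  obtain a where a: "a \<in> actions x" "bellman limit_value x \<theta> = action_value limit_value x a \<theta>"
    using bellman_attained by blast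
  have "limit_value x \<theta> \<le> action_value (value_iter n) x a \<theta>" for n
    using limit_value_le[OF assms, of x "Suc n"] bellman_le[OF a(1), of "value_iter n" \<theta>] by simp
  then have "limit_value x \<theta> \<le> action_value limit_value x a \<theta>"
    by (intro LIMSEQ_le_const[OF action_value_tendsto[OF assms]]) auto
  then show "limit_value x \<theta> \<le> bellman limit_value x \<theta>" using a by simp
next
  note neg = discount_neg[OF assms]
  have "bellman limit_value x \<theta> \<le> value_iter (Suc n) x \<theta>" for n
  proof -
    obtain a where a: "a \<in> actions x"
      "value_iter (Suc n) x \<theta> = action_value (value_iter n) x a \<theta>"
      using bellman_attained[of x "value_iter n" \<theta>] by auto
    have "bellman limit_value x \<theta> \<le> action_value limit_value x a \<theta>"
      by (rule bellman_le[OF a(1)])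
    also have "\<dots> \<le> action_value (value_iter n) x a \<theta>"
      by (intro action_value_mono limit_value_unit value_iter_unit limit_value_le neg)
    finally show ?thesis using a(2) by simp
  qed
  then show "bellman limit_value x \<theta> \<le> limit_value x \<theta>"
    by (intro LIMSEQ_le_const[OF value_iter_tendsto[OF assms, THEN LIMSEQ_Suc]]) auto
qed

lemma value_iter_negative_state: "x < 0 \<Longrightarrow> value_iter n x \<theta> = 1"
  by (induction n arbitrary: \<theta>) (simp_all add: bellman_def action_value_def actions_def successor_def)

lemma limit_value_negative_state: "x < 0 \<Longrightarrow> limit_value x \<theta> = 1"
  by (simp add: limit_value_def value_iter_negative_state)

section \<open>Distance of the value from one\<close>

definition income :: real where
  "income = (LINT z|p. real_of_int (max z 0))"

text \<open>The sum of \<open>\<beta>^k \<cdot> income\<close> over \<open>k \<ge> 1\<close>.\<close>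

definition future_income :: real where
  "future_income = \<beta> * income / (1 - \<beta>)"

lemma income_nonneg: "0 \<le> income"
  unfolding income_def by (intro integral_nonneg_AE) auto

lemma future_income_nonneg: "0 \<le> future_income"
  unfolding future_income_def using income_nonneg discount by simp

lemma one_minus_mult_le:
  fixes u v :: real
  assumes "u \<le> 1" "v \<le> 1"
  shows "1 - u * v \<le> (1 - u) + (1 - v)"
  using mult_nonneg_nonneg[of "1 - u" "1 - v"] assms by (simp add: algebra_simps)

text \<open>The bracket on the right bounds the expected discounted reward from \<open>x\<close>: at best the present
  state is paid out now and every positive increment as soon as it arrives.  The bound is inherited by the next iterate
  because \<open>1 - u v \<le> (1 - u) + (1 - v)\<close> separates the present action from the remaining cost, and
  because \<open>a + \<beta> (x - a) \<le> x\<close>: paying now is no worse than paying later.\<close>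

lemma one_minus_value_iter_le:
  assumes "\<theta> < 0"
  shows "1 - value_iter n x \<theta> \<le> - \<theta> * (real_of_int (max x 0) + future_income)"
  using assms
proof (induction n arbitrary: x \<theta>)
  case 0
  then show ?case using future_income_nonneg by (simp add: mult_nonpos_nonneg)
next
  case (Suc n)
  note neg = discount_neg[OF Suc.prems]
  show ?case
  proof (cases "x < 0")
    case True
    then show ?thesis
      using Suc.prems future_income_nonneg
      by (simp add: value_iter_negative_state mult_nonpos_nonneg del: value_iter.simps)
  next
    case False
    obtain a where a: "a \<in> actions x"
      "value_iter (Suc n) x \<theta> = action_value (value_iter n) x a \<theta>"
      using bellman_attained[of x "value_iter n" \<theta>] by auto
    have a_bounds: "0 \<le> a" "a \<le> x" using actions_bounds[OF a(1)] False by auto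
    define E where "E = (LINT z|p. value_iter n (successor x a z) (\<theta> * \<beta>))"
    have int: "integrable p (\<lambda>z. value_iter n (successor x a z) (\<theta> * \<beta>))"
      using value_iter_unit[OF neg] by (rule integrable_unit)
    have E1: "E \<le> 1"
      using expectation_unit[of "\<lambda>y. value_iter n y (\<theta> * \<beta>)" "successor x a"]
        value_iter_unit[OF neg] by (simp add: E_def)
    have "1 - E = (LINT z|p. 1 - value_iter n (successor x a z) (\<theta> * \<beta>))"
      using int by (simp add: E_def)
    also have "\<dots> \<le> (LINT z|p. - (\<theta> * \<beta>) * (real_of_int (x - a) + future_income + real_of_int (max z 0)))"
    proof (intro integral_mono)
      fix z
      have "1 - value_iter n (successor x a z) (\<theta> * \<beta>)
          \<le> - (\<theta> * \<beta>) * (real_of_int (max (successor x a z) 0) + future_income)"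
        by (rule Suc.IH[OF neg])
      also have "\<dots> \<le> - (\<theta> * \<beta>) * (real_of_int (x - a) + future_income + real_of_int (max z 0))"
        using a_bounds False neg by (intro mult_left_mono) (auto simp: successor_def)
      finally show "1 - value_iter n (successor x a z) (\<theta> * \<beta>) \<le> \<dots>" .
    qed (use int integrable_pos in auto)
    also have "\<dots> = - (\<theta> * \<beta>) * (real_of_int (x - a) + future_income + income)"
      using integrable_pos by (simp add: income_def)
    finally have E2: "1 - E \<le> - (\<theta> * \<beta>) * (real_of_int (x - a) + future_income + income)" .
    \<comment> \<open>\<open>future_income\<close> is chosen to solve this equation, so the additive term reproduces itself.\<close>
    have B: "\<beta> * (future_income + income) = future_income"
      using discount by (simp add: future_income_def field_simps)
    have "1 - value_iter (Suc n) x \<theta> = 1 - exp (\<theta> * real_of_int a) * E"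
      using a(2) by (simp add: action_value_def E_def)
    also have "\<dots> \<le> (1 - exp (\<theta> * real_of_int a)) + (1 - E)"
      using E1 a_bounds Suc.prems by (intro one_minus_mult_le) (auto simp: mult_nonpos_nonneg)
    also have "\<dots> \<le> - \<theta> * real_of_int a - (\<theta> * \<beta>) * (real_of_int (x - a) + future_income + income)"
      using E2 exp_ge_add_one_self[of "\<theta> * real_of_int a"]
      unfolding mult_minus_left by linarith
    also have "\<dots> = - \<theta> * (real_of_int a + \<beta> * real_of_int (x - a) + \<beta> * (future_income + income))"
      by (simp add: algebra_simps)
    also have "\<dots> = - \<theta> * (real_of_int a + \<beta> * real_of_int (x - a) + future_income)"
      by (simp only: B)
    also have "\<dots> \<le> - \<theta> * (real_of_int (max x 0) + future_income)"
    proof (intro mult_left_mono)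
      have "\<beta> * real_of_int (x - a) \<le> real_of_int (x - a)"
        using discount a_bounds by (simp add: mult_left_le_one_le)
      then show "real_of_int a + \<beta> * real_of_int (x - a) + future_income
          \<le> real_of_int (max x 0) + future_income" using False by simp
    qed (use Suc.prems in simp)
    finally show ?thesis .
  qed
qed

lemma one_minus_limit_value_le:
  assumes "\<theta> < 0"
  shows "1 - limit_value x \<theta> \<le> - \<theta> * (real_of_int (max x 0) + future_income)"
proof -
  have "(\<lambda>n. 1 - value_iter n x \<theta>) \<longlonglongrightarrow> 1 - limit_value x \<theta>"
    by (intro tendsto_diff tendsto_const value_iter_tendsto assms)
  then show ?thesis
    by (rule LIMSEQ_le_const2) (use one_minus_value_iter_le[OF assms] in blast)
qed

end

section \<open>Independence of the next increment\<close>

locale controlled_process = prob_space M + bellman_model p \<beta>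
  for M :: "'w measure" and p :: "int pmf" and \<beta> :: real +
  fixes Z :: "nat \<Rightarrow> 'w \<Rightarrow> int"
  assumes indep_increments: "indep_vars (\<lambda>_. count_space UNIV) Z {1..}"
    and distr_increment: "\<And>n. 1 \<le> n \<Longrightarrow> distr M (count_space UNIV) (Z n) = measure_pmf p"
begin

abbreviation increments :: "'w \<Rightarrow> nat \<Rightarrow> int" where
  "increments \<omega> \<equiv> (\<lambda>n. Z n \<omega>)"

lemma measurable_increment: "1 \<le> n \<Longrightarrow> Z n \<in> measurable M (count_space UNIV)"
  using indep_increments unfolding indep_vars_def by auto

text \<open>Initial segments of the increments take countably many values, so that every function of them
  is measurable; this disposes of all measurability questions about policies.\<close>

lemma PiM_initial_count_space:
  "PiM {1..n::nat} (\<lambda>_. count_space UNIV) = count_space (PiE {1..n} (\<lambda>_. UNIV :: int set))"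
  by (rule count_space_PiM_finite) auto

lemma measurable_initial:
  "(\<lambda>\<omega>. restrict (increments \<omega>) {1..n})
     \<in> measurable M (count_space (PiE {1..n} (\<lambda>_. UNIV :: int set)))"
  unfolding PiM_initial_count_space[symmetric]
  by (intro measurable_restrict measurable_increment) auto

lemma measurable_nonanticipating:
  fixes F :: "(nat \<Rightarrow> int) \<Rightarrow> 'c"
  assumes "\<And>z z'. (\<And>i. i \<in> {1..n} \<Longrightarrow> z i = z' i) \<Longrightarrow> F z = F z'"
    and "space N = UNIV"
  shows "(\<lambda>\<omega>. F (increments \<omega>)) \<in> measurable M N"
proof -
  have "F \<in> measurable (count_space (PiE {1..n} (\<lambda>_. UNIV :: int set))) N"
    using assms(2) by simp
  from measurable_compose[OF measurable_initial this]
  have "(\<lambda>\<omega>. F (restrict (increments \<omega>) {1..n})) \<in> measurable M N" .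
  moreover have "F (restrict (increments \<omega>) {1..n}) = F (increments \<omega>)" for \<omega>
    by (rule assms(1)) simp
  ultimately show ?thesis by simp
qed

text \<open>By independence, the joint law of the first \<open>n\<close> increments and the next one is a product
  measure, and by Fubini the next increment may be averaged out first.  The next increment is
  written as a function on the one-element index set \<open>{Suc n}\<close> to give both components of the
  independent pair the same type.\<close>

lemma expectation_fresh_increment:
  fixes F :: "(nat \<Rightarrow> int) \<Rightarrow> int \<Rightarrow> real"
  assumes nonant: "\<And>z z'. (\<And>i. i \<in> {1..n} \<Longrightarrow> z i = z' i) \<Longrightarrow> F z = F z'"
    and bounded: "\<And>z k. \<bar>F z k\<bar> \<le> C"
  shows "(LINT \<omega>|M. F (increments \<omega>) (Z (Suc n) \<omega>)) =
         (LINT \<omega>|M. LINT k|p. F (increments \<omega>) k)"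
proof -
  let ?K = "\<lambda>_::nat. count_space (UNIV :: int set)"
  let ?A = "PiE {1..n} (\<lambda>_. UNIV :: int set)"
  let ?B = "PiE {Suc n} (\<lambda>_. UNIV :: int set)"
  let ?P = "count_space ?A" and ?Q = "count_space ?B"
  let ?X = "\<lambda>\<omega>. restrict (increments \<omega>) {1..n}"
  let ?Y = "\<lambda>\<omega>. restrict (increments \<omega>) {Suc n}"
  have countable: "countable ?A" "countable ?B" by (intro countable_PiE; simp)+
  have PiM_fresh: "PiM {Suc n} ?K = ?Q"
    by (rule count_space_PiM_finite) auto
  have "indep_var (PiM {1..n} ?K) ?X (PiM {Suc n} ?K) ?Y"
    by (intro indep_var_restrict[OF indep_increments]) auto
  then have X: "?X \<in> measurable M ?P" and Y: "?Y \<in> measurable M ?Q"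
    and joint: "distr M (?P \<Otimes>\<^sub>M ?Q) (\<lambda>\<omega>. (?X \<omega>, ?Y \<omega>)) = distr M ?P ?X \<Otimes>\<^sub>M distr M ?Q ?Y"
    unfolding indep_var_distribution_eq PiM_initial_count_space PiM_fresh by simp_all
  interpret X: prob_space "distr M ?P ?X" by (rule prob_space_distr[OF X])
  interpret Y: prob_space "distr M ?Q ?Y" by (rule prob_space_distr[OF Y])
  interpret XY: pair_prob_space "distr M ?P ?X" "distr M ?Q ?Y" ..
  let ?f = "\<lambda>(z, w). F z (w (Suc n))"
  have f_meas: "?f \<in> borel_measurable (?P \<Otimes>\<^sub>M ?Q)"
    using countable by (simp add: pair_measure_countable)
  have f_int: "integrable (distr M ?P ?X \<Otimes>\<^sub>M distr M ?Q ?Y) ?f"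
  proof (rule XY.integrable_const_bound[where B=C])
    show "?f \<in> borel_measurable (distr M ?P ?X \<Otimes>\<^sub>M distr M ?Q ?Y)"
      using f_meas unfolding joint[symmetric] by simp
  qed (use bounded in auto)
  have FX: "F (?X \<omega>) = F (increments \<omega>)" for \<omega>
    by (rule nonant) simp
  have fresh: "(LINT w|distr M ?Q ?Y. F z (w (Suc n))) = (LINT k|p. F z k)" for z
  proof -
    have "(LINT w|distr M ?Q ?Y. F z (w (Suc n))) = (LINT \<omega>|M. F z (Z (Suc n) \<omega>))"
      by (subst integral_distr[OF Y]) simp_all
    also have "\<dots> = (LINT k|distr M (count_space UNIV) (Z (Suc n)). F z k)"
      by (subst integral_distr) (auto intro: measurable_increment)
    finally show ?thesis by (simp add: distr_increment)
  qed
  have "(LINT \<omega>|M. F (increments \<omega>) (Z (Suc n) \<omega>)) = (LINT \<omega>|M. ?f (?X \<omega>, ?Y \<omega>))"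
    by (simp add: FX del: One_nat_def)
  also have "\<dots> = (LINT w|distr M (?P \<Otimes>\<^sub>M ?Q) (\<lambda>\<omega>. (?X \<omega>, ?Y \<omega>)). ?f w)"
    by (rule integral_distr[OF measurable_Pair[OF X Y] f_meas, symmetric])
  also have "\<dots> = (LINT z|distr M ?P ?X. LINT w|distr M ?Q ?Y. ?f (z, w))"
    unfolding joint by (rule XY.integral_fst'[OF f_int, symmetric])
  also have "\<dots> = (LINT z|distr M ?P ?X. LINT k|p. F z k)"
    by (simp add: fresh)
  also have "\<dots> = (LINT \<omega>|M. LINT k|p. F (?X \<omega>) k)"
    by (subst integral_distr[OF X]) simp_all
  finally show ?thesis by (simp add: FX del: One_nat_def)
qed

section \<open>Convergence of the discounted rewards\<close>

abbreviation process :: "policy \<Rightarrow> int \<Rightarrow> nat \<Rightarrow> 'w \<Rightarrow> int" where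
  "process \<pi> x n \<omega> \<equiv> state \<pi> x (increments \<omega>) n"

definition paid :: "policy \<Rightarrow> int \<Rightarrow> nat \<Rightarrow> (nat \<Rightarrow> int) \<Rightarrow> real" where
  "paid \<pi> x n z = (\<Sum>k<n. \<beta> ^ k * real_of_int (act \<pi> x z k))"

lemma act_cong:
  assumes "\<And>i. i \<in> {1..n} \<Longrightarrow> z i = z' i" "k \<le> n"
  shows "act \<pi> x z k = act \<pi> x z' k"
  using history_cong[of k z z' \<pi> x] assms by (simp add: act_eq)

lemma paid_cong:
  assumes "\<And>i. i \<in> {1..n} \<Longrightarrow> z i = z' i"
  shows "paid \<pi> x n z = paid \<pi> x n z'"
  unfolding paid_def using act_cong[OF assms] by (intro sum.cong) auto

lemma measurable_act [measurable]: "(\<lambda>\<omega>. act \<pi> x (increments \<omega>) n) \<in> measurable M (count_space UNIV)"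
  by (rule measurable_nonanticipating[where n=n]) (rule act_cong[where n=n], auto)

lemma measurable_process [measurable]: "process \<pi> x n \<in> measurable M (count_space UNIV)"
  by (rule measurable_nonanticipating[where n=n]) (rule arg_cong[where f=snd, OF history_cong], auto)

lemma measurable_paid [measurable]: "(\<lambda>\<omega>. paid \<pi> x n (increments \<omega>)) \<in> borel_measurable M"
  by (rule measurable_nonanticipating[where n=n]) (rule paid_cong, auto)

lemma act_nonneg: "\<pi> \<in> policies \<Longrightarrow> 0 \<le> act \<pi> x z n"
  using actions_bounds(1)[OF act_in_actions] .

lemma paid_nonneg: "\<pi> \<in> policies \<Longrightarrow> 0 \<le> paid \<pi> x n z"
  unfolding paid_def using discount by (intro sum_nonneg mult_nonneg_nonneg) (auto simp: act_nonneg)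

lemma exp_paid_unit:
  assumes "\<pi> \<in> policies" "\<theta> < 0"
  shows "exp (\<theta> * paid \<pi> x n z) \<in> {0..1}"
  using paid_nonneg[OF assms(1)] assms(2) by (simp add: mult_nonpos_nonneg)

lemma integrable_increment:
  assumes "1 \<le> n"
  shows "integrable M (\<lambda>\<omega>. real_of_int (max (Z n \<omega>) 0))"
    and "(LINT \<omega>|M. real_of_int (max (Z n \<omega>) 0)) = income"
proof -
  have "integrable (distr M (count_space UNIV) (Z n)) (\<lambda>z. real_of_int (max z 0))"
    using integrable_pos by (simp only: distr_increment[OF assms])
  then show "integrable M (\<lambda>\<omega>. real_of_int (max (Z n \<omega>) 0))"
    by (rule integrable_distr[OF measurable_increment[OF assms]])
  show "(LINT \<omega>|M. real_of_int (max (Z n \<omega>) 0)) = income"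
    unfolding income_def distr_increment[OF assms, symmetric]
    by (rule integral_distr[OF measurable_increment[OF assms], symmetric]) simp
qed

text \<open>Actions are nonnegative, so the state is at most the initial state plus all positive
  increments so far.\<close>

lemma expectation_state_le:
  assumes "\<pi> \<in> policies"
  shows "integrable M (\<lambda>\<omega>. real_of_int (max (process \<pi> x n \<omega>) 0))"
    and "(LINT \<omega>|M. real_of_int (max (process \<pi> x n \<omega>) 0)) \<le> real_of_int (max x 0) + n * income"
proof -
  let ?u = "\<lambda>\<omega>. real_of_int (max x 0) + (\<Sum>i=1..n. real_of_int (max (Z i \<omega>) 0))"
  have int_u: "integrable M ?u" by (intro Bochner_Integration.integrable_add
      Bochner_Integration.integrable_sum integrable_increment) auto
  have le: "real_of_int (max (process \<pi> x n \<omega>) 0) \<le> ?u \<omega>" for \<omega>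
  proof -
    have "0 \<le> (\<Sum>i=1..n. max (Z i \<omega>) 0)" by (intro sum_nonneg) auto
    then have "max (process \<pi> x n \<omega>) 0 \<le> max x 0 + (\<Sum>i=1..n. max (Z i \<omega>) 0)"
      using state_le[OF assms, of x "increments \<omega>" n] by simp
    then have "real_of_int (max (process \<pi> x n \<omega>) 0) \<le> real_of_int (max x 0 + (\<Sum>i=1..n. max (Z i \<omega>) 0))"
      by (simp only: of_int_le_iff)
    then show ?thesis by simp
  qed
  show int: "integrable M (\<lambda>\<omega>. real_of_int (max (process \<pi> x n \<omega>) 0))"
    by (rule Bochner_Integration.integrable_bound[OF int_u])
       (use order_trans[OF le abs_ge_self] in auto)
  have "(LINT \<omega>|M. real_of_int (max (process \<pi> x n \<omega>) 0)) \<le> (LINT \<omega>|M. ?u \<omega>)"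
    by (intro integral_mono int int_u le)
  also have "\<dots> = real_of_int (max x 0) + (\<Sum>i=1..n. (LINT \<omega>|M. real_of_int (max (Z i \<omega>) 0)))"
    by (subst Bochner_Integration.integral_add)
       (auto simp: prob_space intro!: Bochner_Integration.integral_sum Bochner_Integration.integrable_sum
          integrable_increment)
  also have "\<dots> = real_of_int (max x 0) + n * income"
    using integrable_increment(2) by simp
  finally show "(LINT \<omega>|M. real_of_int (max (process \<pi> x n \<omega>) 0)) \<le> \<dots>" .
qed

lemma summable_discounted_linear: "summable (\<lambda>n. \<beta> ^ n * (c + real n * d))"
proof -
  have "summable (\<lambda>n. \<beta> ^ n)" "summable (\<lambda>n. real (Suc n) * \<beta> ^ n)"
    using discount geometric_deriv_sums[of \<beta>] by (auto intro: summable_geometric simp: sums_iff)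
  then have "summable (\<lambda>n. (c - d) * \<beta> ^ n + d * (real (Suc n) * \<beta> ^ n))"
    by (intro summable_add summable_mult)
  then show ?thesis by (simp add: algebra_simps)
qed

text \<open>An action is at most the positive part of the state, whose expectation grows linearly;
  hence the discounted series has finite expectation.\<close>

lemma AE_summable_rewards:
  assumes "\<pi> \<in> policies"
  shows "AE \<omega> in M. summable (\<lambda>k. \<beta> ^ k * real_of_int (act \<pi> x (increments \<omega>) k))"
proof -
  let ?r = "\<lambda>k \<omega>. \<beta> ^ k * real_of_int (act \<pi> x (increments \<omega>) k)"
  let ?b = "\<lambda>k. \<beta> ^ k * (real_of_int (max x 0) + real k * income)"
  have r_nonneg: "0 \<le> ?r k \<omega>" for k \<omega>
    using discount act_nonneg[OF assms] by simp
  have r_expectation: "(\<integral>\<^sup>+\<omega>. ennreal (?r k \<omega>) \<partial>M) \<le> ennreal (?b k)" for k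
  proof -
    have act_le: "?r k \<omega> \<le> \<beta> ^ k * real_of_int (max (process \<pi> x k \<omega>) 0)" for \<omega>
      using actions_bounds(2)[OF act_in_actions[OF assms, of x "increments \<omega>" k]] discount
      by (intro mult_left_mono) (auto simp only: of_int_le_iff zero_le_power less_imp_le)
    have "(\<integral>\<^sup>+\<omega>. ennreal (?r k \<omega>) \<partial>M) \<le> (\<integral>\<^sup>+\<omega>. ennreal (\<beta> ^ k * real_of_int (max (process \<pi> x k \<omega>) 0)) \<partial>M)"
      by (intro nn_integral_mono ennreal_leI act_le)
    also have "\<dots> = ennreal (LINT \<omega>|M. \<beta> ^ k * real_of_int (max (process \<pi> x k \<omega>) 0))"
      using discount by (intro nn_integral_eq_integral integrable_mult_right expectation_state_le assms) auto
    also have "\<dots> \<le> ennreal (?b k)"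
      using discount expectation_state_le(2)[OF assms, of x k]
      by (intro ennreal_leI) (simp add: mult_left_mono)
    finally show ?thesis .
  qed
  have "(\<integral>\<^sup>+\<omega>. (\<Sum>k. ennreal (?r k \<omega>)) \<partial>M) = (\<Sum>k. \<integral>\<^sup>+\<omega>. ennreal (?r k \<omega>) \<partial>M)"
    by (intro nn_integral_suminf) simp
  also have "\<dots> \<le> (\<Sum>k. ennreal (?b k))"
    by (intro suminf_le r_expectation) auto
  also have "\<dots> = ennreal (\<Sum>k. ?b k)"
    using discount income_nonneg by (intro suminf_ennreal2 summable_discounted_linear) auto
  finally have "(\<integral>\<^sup>+\<omega>. (\<Sum>k. ennreal (?r k \<omega>)) \<partial>M) \<noteq> \<infinity>"
    by (auto simp: top_unique)
  then have "AE \<omega> in M. (\<Sum>k. ennreal (?r k \<omega>)) \<noteq> \<infinity>"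
    by (intro nn_integral_PInf_AE) auto
  then show ?thesis
    by eventually_elim (rule summable_suminf_not_top[OF r_nonneg], simp)
qed

text \<open>Because the series converges almost surely, \<open>total_reward\<close> is almost surely the limit of the
  partial sums, and the exponentials are dominated by \<open>1\<close>.\<close>

lemma exp_paid_tendsto_J_of:
  assumes "\<pi> \<in> policies" "\<theta> < 0"
  shows "(\<lambda>n. LINT \<omega>|M. exp (\<theta> * paid \<pi> x n (increments \<omega>))) \<longlonglongrightarrow> J_of M Z \<beta> \<pi> x \<theta>"
  unfolding J_of_def
proof (rule integral_dominated_convergence[where w="\<lambda>_. 1"])
  show "AE \<omega> in M. (\<lambda>n. exp (\<theta> * paid \<pi> x n (increments \<omega>)))
      \<longlonglongrightarrow> exp (\<theta> * total_reward \<beta> \<pi> x (increments \<omega>))"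
    using AE_summable_rewards[OF assms(1), of x]
    by eventually_elim
       (auto simp: paid_def total_reward_def intro!: tendsto_exp tendsto_mult summable_LIMSEQ)
  show "(\<lambda>\<omega>. exp (\<theta> * total_reward \<beta> \<pi> x (increments \<omega>))) \<in> borel_measurable M"
    unfolding total_reward_def by measurable
qed (use exp_paid_unit[OF assms] in auto)

section \<open>The verification argument\<close>

text \<open>The cost of following \<open>\<pi>\<close> for \<open>n\<close> steps where the factor
  \<open>limit_value\<close> stands for an ideal continuation.\<close>

definition continuation_cost :: "policy \<Rightarrow> int \<Rightarrow> real \<Rightarrow> nat \<Rightarrow> real" where
  "continuation_cost \<pi> x \<theta> n =
     (LINT \<omega>|M. exp (\<theta> * paid \<pi> x n (increments \<omega>)) * limit_value (process \<pi> x n \<omega>) (\<theta> * \<beta> ^ n))"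

lemma scaled_neg: "\<theta> < 0 \<Longrightarrow> \<theta> * \<beta> ^ n < 0"
  using discount by (simp add: mult_neg_pos)

lemma continuation_cost_0 [simp]: "continuation_cost \<pi> x \<theta> 0 = limit_value x \<theta>"
  by (simp add: continuation_cost_def paid_def prob_space)

text \<open>This is the Markov property: given the first \<open>n\<close> increments, the factor
  \<open>exp (\<theta> \<beta>^n a)\<close> and the average over the next increment combine to an action value.\<close>

lemma continuation_cost_Suc:
  assumes "\<pi> \<in> policies" "\<theta> < 0"
  shows "continuation_cost \<pi> x \<theta> (Suc n) =
     (LINT \<omega>|M. exp (\<theta> * paid \<pi> x n (increments \<omega>)) *
        action_value limit_value (process \<pi> x n \<omega>) (act \<pi> x (increments \<omega>) n) (\<theta> * \<beta> ^ n))"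
proof -
  let ?F = "\<lambda>z k. exp (\<theta> * paid \<pi> x (Suc n) z) *
    limit_value (successor (state \<pi> x z n) (act \<pi> x z n) k) (\<theta> * \<beta> ^ Suc n)"
  have nonant: "?F z = ?F z'" if "\<And>i. i \<in> {1..n} \<Longrightarrow> z i = z' i" for z z'
    using history_cong[of n z z', OF that] act_cong[of n z z', OF that] paid_cong[of n z z', OF that]
    by (simp add: paid_def)
  have bounded: "\<bar>?F z k\<bar> \<le> 1" for z k
    using exp_paid_unit[OF assms, of x "Suc n" z]
      limit_value_unit[OF scaled_neg[OF assms(2)], of "successor (state \<pi> x z n) (act \<pi> x z n) k" "Suc n"]
    by (auto simp: abs_mult intro: mult_le_one)
  have "continuation_cost \<pi> x \<theta> (Suc n) = (LINT \<omega>|M. ?F (increments \<omega>) (Z (Suc n) \<omega>))"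
    unfolding continuation_cost_def state_Suc ..
  also have "\<dots> = (LINT \<omega>|M. LINT k|p. ?F (increments \<omega>) k)"
    by (rule expectation_fresh_increment[OF nonant bounded])
  also have "\<dots> = (LINT \<omega>|M. exp (\<theta> * paid \<pi> x n (increments \<omega>)) *
        action_value limit_value (process \<pi> x n \<omega>) (act \<pi> x (increments \<omega>) n) (\<theta> * \<beta> ^ n))"
    by (simp add: action_value_def paid_def algebra_simps exp_add)
  finally show ?thesis .
qed

lemma integrable_exp_paid_mult:
  assumes "\<pi> \<in> policies" "\<theta> < 0" "\<And>y. f y \<in> {0..1}"
  shows "integrable M (\<lambda>\<omega>. exp (\<theta> * paid \<pi> x n (increments \<omega>)) * f (process \<pi> x n \<omega>))"
proof (rule integrable_const_bound[where B=1])
  show "AE \<omega> in M. norm (exp (\<theta> * paid \<pi> x n (increments \<omega>)) * f (process \<pi> x n \<omega>)) \<le> 1"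
    using exp_paid_unit[OF assms(1,2)] assms(3)
    by (intro AE_I2) (auto simp: abs_mult intro!: mult_le_one)
qed measurable

lemma limit_value_le_action_value:
  assumes "\<theta> < 0" "a \<in> actions x"
  shows "limit_value x \<theta> \<le> action_value limit_value x a \<theta>"
  using limit_value_fixpoint[OF assms(1)] bellman_le[OF assms(2)] by simp

lemma action_value_unit:
  assumes "\<theta> < 0" "a \<in> actions x"
  shows "action_value limit_value x a \<theta> \<in> {0..1}"
  using expectation_unit[of "\<lambda>y. limit_value y (\<theta> * \<beta>)" "successor x a",
      OF limit_value_unit[OF discount_neg[OF assms(1)]]]
    actions_bounds(1)[OF assms(2)] assms(1)
  by (auto simp: action_value_def mult_nonpos_nonneg intro!: mult_le_one)

lemma continuation_cost_mono:
  assumes "\<pi> \<in> policies" "\<theta> < 0"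
  shows "continuation_cost \<pi> x \<theta> n \<le> continuation_cost \<pi> x \<theta> (Suc n)"
proof -
  let ?v = "\<lambda>\<omega>. exp (\<theta> * paid \<pi> x n (increments \<omega>)) *
      limit_value (process \<pi> x n \<omega>) (\<theta> * \<beta> ^ n)"
  let ?w = "\<lambda>\<omega>. exp (\<theta> * paid \<pi> x n (increments \<omega>)) *
      action_value limit_value (process \<pi> x n \<omega>) (act \<pi> x (increments \<omega>) n) (\<theta> * \<beta> ^ n)"
  have "integrable M ?v"
    by (intro integrable_exp_paid_mult limit_value_unit scaled_neg assms)
  moreover have "integrable M ?w"
  proof (rule integrable_const_bound[where B=1])
    show "AE \<omega> in M. norm (?w \<omega>) \<le> 1"
      using exp_paid_unit[OF assms] action_value_unit[OF scaled_neg[OF assms(2)] act_in_actions[OF assms(1)]]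
      by (intro AE_I2) (auto simp: abs_mult intro!: mult_le_one)
  qed measurable
  moreover have "?v \<omega> \<le> ?w \<omega>" for \<omega>
    by (intro mult_left_mono limit_value_le_action_value scaled_neg act_in_actions assms) simp
  ultimately show ?thesis
    unfolding continuation_cost_Suc[OF assms] unfolding continuation_cost_def by (intro integral_mono)
qed

text \<open>The continuation cost starts at \<open>limit_value x \<theta>\<close>, never decreases, and stays below the expectation
  of \<open>exp (\<theta> \<cdot> paid)\<close>, which tends to the cost of the policy.\<close>

lemma limit_value_le_J_of:
  assumes "\<pi> \<in> policies" "\<theta> < 0"
  shows "limit_value x \<theta> \<le> J_of M Z \<beta> \<pi> x \<theta>"
proof (rule LIMSEQ_le_const[OF exp_paid_tendsto_J_of[OF assms]], intro exI allI impI)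
  fix n
  have "limit_value x \<theta> \<le> continuation_cost \<pi> x \<theta> n"
    using lift_Suc_mono_le[of "continuation_cost \<pi> x \<theta>" 0 n] continuation_cost_mono[OF assms] by simp
  also have "\<dots> \<le> (LINT \<omega>|M. exp (\<theta> * paid \<pi> x n (increments \<omega>)))"
    unfolding continuation_cost_def
  proof (intro integral_mono integrable_exp_paid_mult limit_value_unit scaled_neg assms)
    show "integrable M (\<lambda>\<omega>. exp (\<theta> * paid \<pi> x n (increments \<omega>)))"
      using integrable_exp_paid_mult[OF assms, of "\<lambda>_. 1"] by simp
    show "exp (\<theta> * paid \<pi> x n (increments \<omega>)) * limit_value (process \<pi> x n \<omega>) (\<theta> * \<beta> ^ n)
        \<le> exp (\<theta> * paid \<pi> x n (increments \<omega>))" for \<omega>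
      using limit_value_unit[OF scaled_neg[OF assms(2), of n], of "process \<pi> x n \<omega>"]
      by (simp add: mult_left_le)
  qed
  finally show "limit_value x \<theta> \<le> (LINT \<omega>|M. exp (\<theta> * paid \<pi> x n (increments \<omega>)))" .
qed

text \<open>The parameter at time \<open>n\<close> is \<open>\<theta> \<beta>^n\<close>, so the minimising action depends on the time
  although the model is stationary.\<close>

definition greedy :: "real \<Rightarrow> (nat \<Rightarrow> int \<Rightarrow> int) \<Rightarrow> bool" where
  "greedy \<theta> g \<longleftrightarrow> (\<forall>n x. g n x \<in> actions x \<and>
     action_value limit_value x (g n x) (\<theta> * \<beta> ^ n) = limit_value x (\<theta> * \<beta> ^ n))"

text \<open>Along a greedy policy the continuation cost is constant.  It differs from the expectation of
  \<open>exp (\<theta> \<cdot> paid)\<close> by at most the expectation of \<open>1 - limit_value\<close> at time \<open>n\<close>, which is bounded by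
  \<open>\<beta>^n\<close> times a linear function of \<open>n\<close>.\<close>

lemma J_of_greedy:
  assumes "greedy \<theta> g" "\<theta> < 0"
  shows "J_of M Z \<beta> (markov g) x \<theta> = limit_value x \<theta>"
proof (rule antisym)
  let ?\<pi> = "markov g"
  let ?E = "\<lambda>n. LINT \<omega>|M. exp (\<theta> * paid ?\<pi> x n (increments \<omega>))"
  let ?V = "\<lambda>n \<omega>. limit_value (process ?\<pi> x n \<omega>) (\<theta> * \<beta> ^ n)"
  let ?b = "\<lambda>n. \<beta> ^ n * ((real_of_int (max x 0) + future_income) + real n * income)"
  have pol: "?\<pi> \<in> policies"
    using assms(1) by (simp add: greedy_def markov_in_policies_iff)
  show "limit_value x \<theta> \<le> J_of M Z \<beta> ?\<pi> x \<theta>"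
    by (rule limit_value_le_J_of[OF pol assms(2)])
  have const: "continuation_cost ?\<pi> x \<theta> n = limit_value x \<theta>" for n
  proof (induction n)
    case (Suc n)
    have "continuation_cost ?\<pi> x \<theta> (Suc n) = continuation_cost ?\<pi> x \<theta> n"
      using assms(1) unfolding continuation_cost_Suc[OF pol assms(2)]
      by (simp add: continuation_cost_def act_markov greedy_def)
    with Suc show ?case by simp
  qed simp
  have E_le: "?E n \<le> limit_value x \<theta> - \<theta> * ?b n" for n
  proof -
    note V_unit = limit_value_unit[OF scaled_neg[OF assms(2), of n]]
    have int: "integrable M (\<lambda>\<omega>. exp (\<theta> * paid ?\<pi> x n (increments \<omega>)))"
      using integrable_exp_paid_mult[OF pol assms(2), of "\<lambda>_. 1"] by simp
    have int_V: "integrable M (\<lambda>\<omega>. exp (\<theta> * paid ?\<pi> x n (increments \<omega>)) * ?V n \<omega>)"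
      by (intro integrable_exp_paid_mult[OF pol assms(2)] V_unit)
    have int_state: "integrable M (\<lambda>\<omega>. real_of_int (max (process ?\<pi> x n \<omega>) 0))"
      by (rule expectation_state_le(1)[OF pol])
    have "?E n - limit_value x \<theta> = (LINT \<omega>|M. exp (\<theta> * paid ?\<pi> x n (increments \<omega>))
        - exp (\<theta> * paid ?\<pi> x n (increments \<omega>)) * ?V n \<omega>)"
      using int int_V const[of n] by (simp add: continuation_cost_def)
    also have "\<dots> \<le> (LINT \<omega>|M. - (\<theta> * \<beta> ^ n) * (real_of_int (max (process ?\<pi> x n \<omega>) 0) + future_income))"
    proof (intro integral_mono Bochner_Integration.integrable_diff int int_V)
      show "integrable M (\<lambda>\<omega>. - (\<theta> * \<beta> ^ n) * (real_of_int (max (process ?\<pi> x n \<omega>) 0) + future_income))"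
        using int_state by (intro integrable_mult_right Bochner_Integration.integrable_add) auto
      fix \<omega>
      have "exp (\<theta> * paid ?\<pi> x n (increments \<omega>)) * (1 - ?V n \<omega>) \<le> 1 - ?V n \<omega>"
        using exp_paid_unit[OF pol assms(2), of x n "increments \<omega>"] V_unit[of "process ?\<pi> x n \<omega>"]
        by (intro mult_left_le_one_le) auto
      also have "\<dots> \<le> - (\<theta> * \<beta> ^ n) * (real_of_int (max (process ?\<pi> x n \<omega>) 0) + future_income)"
        by (intro one_minus_limit_value_le scaled_neg assms)
      finally show "exp (\<theta> * paid ?\<pi> x n (increments \<omega>))
        - exp (\<theta> * paid ?\<pi> x n (increments \<omega>)) * ?V n \<omega> \<le> \<dots>"
        by (simp add: right_diff_distrib)
    qed
    also have "\<dots> = - (\<theta> * \<beta> ^ n) * ((LINT \<omega>|M. real_of_int (max (process ?\<pi> x n \<omega>) 0)) + future_income)"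
      using int_state by (simp add: prob_space del: of_int_max)
    also have "\<dots> \<le> - (\<theta> * \<beta> ^ n) * (real_of_int (max x 0) + n * income + future_income)"
      using expectation_state_le(2)[OF pol, of x n] scaled_neg[OF assms(2), of n]
      by (intro mult_left_mono) auto
    finally show ?thesis by (simp add: algebra_simps)
  qed
  have "(\<lambda>n. limit_value x \<theta> - \<theta> * ?b n) \<longlonglongrightarrow> limit_value x \<theta> - \<theta> * 0"
    by (intro tendsto_intros summable_LIMSEQ_zero summable_discounted_linear)
  with exp_paid_tendsto_J_of[OF pol assms(2), of x]
  show "J_of M Z \<beta> ?\<pi> x \<theta> \<le> limit_value x \<theta>"
    using E_le by (intro LIMSEQ_le[where X="?E" and Y="\<lambda>n. limit_value x \<theta> - \<theta> * ?b n"]) auto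
qed

lemma greedy_exists:
  assumes "\<theta> < 0"
  obtains g where "greedy \<theta> g"
proof -
  define g where "g n x = (SOME a. a \<in> actions x \<and>
    action_value limit_value x a (\<theta> * \<beta> ^ n) = limit_value x (\<theta> * \<beta> ^ n))" for n x
  have "\<exists>a. a \<in> actions x \<and> action_value limit_value x a (\<theta> * \<beta> ^ n) = limit_value x (\<theta> * \<beta> ^ n)" for n x
    using bellman_attained[of x limit_value "\<theta> * \<beta> ^ n"] limit_value_fixpoint[OF scaled_neg[OF assms, of n], of x]
    by metis
  from someI_ex[OF this] have "greedy \<theta> g"
    unfolding greedy_def g_def by blast
  then show thesis by (rule that)
qed

text \<open>The optimal cost has to be identified for every \<open>\<theta> < 0\<close> with some greedy policy before
  anything can be said about \<open>fstar\<close>, because \<open>fstar\<close> is defined through the optimal cost.\<close>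

lemma J_opt_eq_limit_value:
  assumes "\<theta> < 0"
  shows "J_opt M Z \<beta> x \<theta> = limit_value x \<theta>"
proof -
  obtain g where g: "greedy \<theta> g" using greedy_exists[OF assms] .
  then have pol: "markov g \<in> policies" by (simp add: greedy_def markov_in_policies_iff)
  show ?thesis unfolding J_opt_def
  proof (rule cInf_eq_minimum)
    show "limit_value x \<theta> \<in> (\<lambda>\<pi>. J_of M Z \<beta> \<pi> x \<theta>) ` policies"
      using J_of_greedy[OF g assms, of x] pol by force
  qed (use limit_value_le_J_of[OF _ assms] in auto)
qed

section \<open>The policy of largest minimisers\<close>

text \<open>The second sum in \<^const>\<open>G\<close> covers the increments that lead to ruin, where the value is \<open>1\<close>.\<close>

lemma G_eq_expectation:
  assumes "\<And>k. q k = pmf p k" "0 \<le> y" "\<theta> < 0"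
  shows "G M Z q \<beta> y \<theta> = (LINT z|p. limit_value (y + z) \<theta>)"
proof -
  let ?h = "\<lambda>k. pmf p k * limit_value (y + k) \<theta>"
  have "integrable p (\<lambda>z. limit_value (y + z) \<theta>)"
    using limit_value_unit[OF assms(3)] by (rule integrable_unit)
  then have abs_summable: "Infinite_Set_Sum.abs_summable_on ?h UNIV"
    by (simp add: abs_summable_on_def measure_pmf_eq_density integrable_density)
  then have summable: "?h summable_on A" for A
    by (meson abs_summable_equivalent abs_summable_summable summable_on_subset_banach top_greatest)
  have "(LINT z|p. limit_value (y + z) \<theta>) = infsum ?h UNIV"
    unfolding pmf_expectation_eq_infsetsum using infsetsum_infsum[OF abs_summable] .
  also have "UNIV = {-y..} \<union> {..-y - 1}" by auto
  also have "infsum ?h \<dots> = infsum ?h {-y..} + infsum ?h {..-y - 1}"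
    by (intro infsum_Un_disjoint summable) auto
  also have "\<dots> = G M Z q \<beta> y \<theta>"
    unfolding G_def
    by (intro arg_cong2[where f="(+)"] infsum_cong)
       (auto simp: assms(1) J_opt_eq_limit_value[OF assms(3)] limit_value_negative_state)
  finally show ?thesis ..
qed

lemma fstar_greedy:
  assumes q: "\<And>k. q k = pmf p k" and "\<theta> < 0"
  shows "fstar M Z q \<beta> x \<theta> \<in> actions x"
    and "action_value limit_value x (fstar M Z q \<beta> x \<theta>) \<theta> = limit_value x \<theta>"
proof -
  have "fstar M Z q \<beta> x \<theta> \<in> actions x \<and>
    action_value limit_value x (fstar M Z q \<beta> x \<theta>) \<theta> = limit_value x \<theta>"
  proof (cases "0 \<le> x")
    case False
    then show ?thesis
      by (simp add: fstar_def action_value_def successor_def limit_value_negative_state)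
  next
    case True
    let ?c = "\<lambda>a. exp (\<theta> * real_of_int a) * G M Z q \<beta> (x - a) (\<theta> * \<beta>)"
    let ?S = "{a. is_arg_min ?c (\<lambda>a. a \<in> actions x) a}"
    have c: "?c a = action_value limit_value x a \<theta>" if "a \<in> actions x" for a
      using that True actions_bounds[OF that] discount_neg[OF assms(2)]
      by (simp add: G_eq_expectation[OF q] action_value_def successor_def)
    have "finite ?S" by (rule finite_subset[OF _ finite_actions[of x]]) (auto simp: is_arg_min_def)
    moreover have "?S \<noteq> {}"
      using ex_is_arg_min_if_finite[OF finite_actions actions_nonempty, of ?c x] by auto
    ultimately have "Max ?S \<in> ?S" by (rule Max_in)
    then have f: "is_arg_min ?c (\<lambda>a. a \<in> actions x) (fstar M Z q \<beta> x \<theta>)"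
      using True by (simp add: fstar_def)
    then have f_in: "fstar M Z q \<beta> x \<theta> \<in> actions x" by (simp add: is_arg_min_def)
    obtain a where a: "a \<in> actions x" "limit_value x \<theta> = action_value limit_value x a \<theta>"
      using bellman_attained[of x limit_value \<theta>] limit_value_fixpoint[OF assms(2)] by metis
    have "?c (fstar M Z q \<beta> x \<theta>) \<le> ?c a"
      using f a(1) by (auto simp: is_arg_min_linorder)
    then have "action_value limit_value x (fstar M Z q \<beta> x \<theta>) \<theta> \<le> limit_value x \<theta>"
      using c f_in a by simp
    with limit_value_le_action_value[OF assms(2) f_in] f_in show ?thesis by simp
  qed
  then show "fstar M Z q \<beta> x \<theta> \<in> actions x"
    and "action_value limit_value x (fstar M Z q \<beta> x \<theta>) \<theta> = limit_value x \<theta>" by auto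
qed

end

lemma utility_of_eq_J_of:
  "utility_of M Z \<beta> \<gamma> \<pi> x = 1 / \<gamma> * J_of M Z \<beta> \<pi> x \<gamma>"
  by (simp add: utility_of_def J_of_def exp_utility_def)

text \<open>On a countable space the points of measure zero together form a null set.\<close>

lemma countable_prob_space_is_pmf:
  fixes N :: "'a::countable measure"
  assumes "prob_space N" "sets N = UNIV"
  obtains p where "measure_pmf p = N"
proof -
  interpret prob_space N by fact
  have "{x. measure N {x} = 0} = (\<Union>x\<in>{x. measure N {x} = 0}. {x})" by auto
  moreover have "(\<Union>x\<in>{x. measure N {x} = 0}. {x}) \<in> null_sets N"
    by (intro null_sets_UN') (auto simp: assms(2) null_sets_def emeasure_eq_measure)
  ultimately have "{x. measure N {x} = 0} \<in> null_sets N" by simp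
  then have "AE x in N. measure N {x} \<noteq> 0" by (rule AE_I') auto
  then have "measure_pmf (Abs_pmf N) = N"
    using assms by (intro Abs_pmf_inverse) auto
  then show thesis by (rule that)
qed

theorem theorem3p11:
  fixes M :: "'w measure" and Z :: "nat \<Rightarrow> 'w \<Rightarrow> int" and q :: "int \<Rightarrow> real"
    and \<beta> \<gamma> :: real
  assumes "prob_space M"
    and "prob_space.indep_vars M (\<lambda>_. count_space UNIV) Z {1..}"
    and "\<And>n k. 1 \<le> n \<Longrightarrow> measure M {\<omega> \<in> space M. Z n \<omega> = k} = q k"
    and "integrable M (\<lambda>\<omega>. real_of_int (max (Z 1 \<omega>) 0))"
    and "measure M {\<omega> \<in> space M. Z 1 \<omega> < 0} > 0"
    and "0 < \<beta>" and "\<beta> < 1"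
    and "\<gamma> < 0"
  shows "pi_star M Z q \<beta> \<gamma> \<in> markov_policies \<and>
    (\<forall>x. utility_opt M Z \<beta> \<gamma> x = utility_of M Z \<beta> \<gamma> (pi_star M Z q \<beta> \<gamma>) x \<and>
         utility_of M Z \<beta> \<gamma> (pi_star M Z q \<beta> \<gamma>) x = 1 / \<gamma> * J_of M Z \<beta> (pi_star M Z q \<beta> \<gamma>) x \<gamma> \<and>
         1 / \<gamma> * J_of M Z \<beta> (pi_star M Z q \<beta> \<gamma>) x \<gamma> = 1 / \<gamma> * J_opt M Z \<beta> x \<gamma>)"
proof -
  interpret prob_space M by fact
  have Z_meas: "Z n \<in> measurable M (count_space UNIV)" if "1 \<le> n" for n
    using assms(2) that unfolding indep_vars_def by auto
  have point: "measure (distr M (count_space UNIV) (Z n)) {k} = q k" if "1 \<le> n" for n k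
    using assms(3)[OF that, of k]
    by (subst measure_distr[OF Z_meas[OF that]]) (simp_all add: vimage_def Int_def conj_commute)
  obtain p where p: "measure_pmf p = distr M (count_space UNIV) (Z 1)"
    using countable_prob_space_is_pmf[OF prob_space_distr[OF Z_meas[of 1]]] by auto
  have q: "q k = pmf p k" for k
    using point[of 1 k] by (simp add: p pmf.rep_eq)
  have Z_distr: "distr M (count_space UNIV) (Z n) = measure_pmf p" if "1 \<le> n" for n
  proof -
    interpret Zn: prob_space "distr M (count_space UNIV) (Z n)"
      by (rule prob_space_distr[OF Z_meas[OF that]])
    show ?thesis
      by (rule measure_eqI_countable[where A=UNIV])
         (simp_all add: Zn.emeasure_eq_measure measure_pmf.emeasure_eq_measure point[OF that] q pmf.rep_eq)
  qed
  have "integrable p (\<lambda>z. real_of_int (max z 0))"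
    unfolding p using assms(4) by (subst integrable_distr_eq[OF Z_meas]) simp_all
  then interpret controlled_process M p \<beta> Z
    using assms(2,6,7) Z_distr by unfold_locales auto
  let ?g = "\<lambda>n x. fstar M Z q \<beta> x (\<gamma> * \<beta> ^ n)"
  have g: "greedy \<gamma> ?g"
    unfolding greedy_def using fstar_greedy[OF q scaled_neg[OF assms(8)]] by blast
  then have pol: "pi_star M Z q \<beta> \<gamma> \<in> policies"
    unfolding pi_star_def by (simp add: markov_in_policies_iff greedy_def)
  then have markov: "pi_star M Z q \<beta> \<gamma> \<in> markov_policies"
    using g unfolding markov_policies_def pi_star_def greedy_def
    by (intro CollectI conjI exI[of _ ?g]) auto
  have J_star: "J_of M Z \<beta> (pi_star M Z q \<beta> \<gamma>) x \<gamma> = limit_value x \<gamma>" for x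
    unfolding pi_star_def by (rule J_of_greedy[OF g assms(8)])
  have "utility_opt M Z \<beta> \<gamma> x = 1 / \<gamma> * limit_value x \<gamma>" for x
    unfolding utility_opt_def utility_of_eq_J_of
  proof (rule cSup_eq_maximum)
    show "1 / \<gamma> * limit_value x \<gamma> \<in> (\<lambda>\<pi>. 1 / \<gamma> * J_of M Z \<beta> \<pi> x \<gamma>) ` policies"
      using pol J_star[of x] by force
  qed (use limit_value_le_J_of[OF _ assms(8)] assms(8) in \<open>auto simp: divide_simps\<close>)
  then show ?thesis
    using markov by (simp add: utility_of_eq_J_of J_star J_opt_eq_limit_value[OF assms(8)])
qed

end
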